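(* Let $s=(s_1,\dots,s_n)$ be a composition and let $\mathbf d$ be the netflow on the $s$-oruga graph $\mathcal O(s)$ given by the shifted in-degrees, i.e. $\mathbf d=(0,0,s_n,s_{n-1},\dots,s_2,-(s_2+\cdots+s_n))$ on the vertices $(v_{-1},v_0,v_1,\dots,v_{n-1},v_n)$. The set of Stirling $s$-permutations is in bijection with the set of integer $\mathbf d$-flows of $\mathcal O(s)$.
   Context: A composition is a sequence of positive integers. A Stirling $s$-permutation is a rearrangement of the word $1^{s_1}2^{s_2}\cdots n^{s_n}$ avoiding the pattern $121$ (no $a<b$ with $a,b,a$ appearing in this order). Set $s_{n+1}:=2$. The $s$-oruga graph $\mathcal O(s)$ is the directed multigraph on $v_{-1},v_0,\dots,v_n$ with: for each $i\in[n+1]$, $s_i-1$ source edges $v_{-1}\to v_{n+1-i}$; for each $i\in[n]$, two parallel edges (bump and dip) $v_{n-i}\to v_{n+1-i}$. For a netflow $\mathbf a=(a_v)$ with $\sum_v a_v=0$, an $\mathbf a$-flow is $f:E\to\mathbb R_{\ge0}$ with $\sum_{e \text{ out of } v}f(e)-\sum_{e\text{ into } v}f(e)=a_v$ at every vertex $v$; it is integer if all values are integers. The shifted in-degree of $v$ is its in-degree minus one (with value $0$ at the source $v_{-1}$, and the sink value chosen so the total is $0$). *)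

theory Defs
  imports Complex_Main "HOL-Library.FuncSet" "HOL-Library.Multiset" "HOL-Library.Sublist"
    "Graph_Theory.Digraph"
begin

text \<open>A composition \<open>s = (s\<^sub>1, \<dots>, s\<^sub>n)\<close> is a list of length \<open>n\<close>, so \<open>s\<^sub>i\<close> is \<open>s ! (i - 1)\<close>.\<close>

definition composition :: "nat list \<Rightarrow> bool" where
  "composition s \<longleftrightarrow> (\<forall>x\<in>set s. 0 < x)"

text \<open>The part \<open>s\<^sub>i\<close> for \<open>1 \<le> i \<le> n + 1\<close>, with the convention \<open>s\<^sub>n\<^sub>+\<^sub>1 = 2\<close>.\<close>

definition part :: "nat list \<Rightarrow> nat \<Rightarrow> nat" where
  "part s i = (if i = length s + 1 then 2 else s ! (i - 1))"

definition base_word :: "nat list \<Rightarrow> nat list" where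
  "base_word s = concat (map (\<lambda>i. replicate (part s i) i) [1..<length s + 1])"

definition avoids_121 :: "nat list \<Rightarrow> bool" where
  "avoids_121 w \<longleftrightarrow> \<not> (\<exists>a b. a < b \<and> subseq [a, b, a] w)"

definition stirling_permutations :: "nat list \<Rightarrow> nat list set" where
  "stirling_permutations s = {w. mset w = mset (base_word s) \<and> avoids_121 w}"

text \<open>
  The vertex \<open>v\<^sub>k\<close> is the integer \<open>k\<close>, for \<open>-1 \<le> k \<le> n\<close>.
  \<open>Source i j\<close> is the \<open>j\<close>-th of the \<open>s\<^sub>i - 1\<close> parallel edges from \<open>v\<^sub>-\<^sub>1\<close> to \<open>v\<^sub>n\<^sub>+\<^sub>1\<^sub>-\<^sub>i\<close>;
  \<open>Bump i\<close> and \<open>Dip i\<close> are the two parallel edges from \<open>v\<^sub>n\<^sub>-\<^sub>i\<close> to \<open>v\<^sub>n\<^sub>+\<^sub>1\<^sub>-\<^sub>i\<close>.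
\<close>

datatype oruga_edge = Source nat nat | Bump nat | Dip nat

fun oruga_tail :: "nat \<Rightarrow> oruga_edge \<Rightarrow> int" where
  "oruga_tail n (Source i j) = -1"
| "oruga_tail n (Bump i) = int n - int i"
| "oruga_tail n (Dip i) = int n - int i"

fun oruga_head :: "nat \<Rightarrow> oruga_edge \<Rightarrow> int" where
  "oruga_head n (Source i j) = int n + 1 - int i"
| "oruga_head n (Bump i) = int n + 1 - int i"
| "oruga_head n (Dip i) = int n + 1 - int i"

definition oruga :: "nat list \<Rightarrow> (int, oruga_edge) pre_digraph" where
  "oruga s = \<lparr>
     verts = {-1..int (length s)},
     arcs = {Source i j | i j. i \<in> {1..length s + 1} \<and> j \<in> {1..part s i - 1}}
          \<union> Bump ` {1..length s} \<union> Dip ` {1..length s},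
     tail = oruga_tail (length s),
     head = oruga_head (length s)\<rparr>"

definition netflow :: "('a, 'b) pre_digraph \<Rightarrow> ('a \<Rightarrow> real) \<Rightarrow> bool" where
  "netflow G a \<longleftrightarrow> (\<Sum>v\<in>verts G. a v) = 0"

text \<open>
  A flow is a function on the arc set; it is taken to be \<open>undefined\<close> outside
  \<open>arcs G\<close>, so that each flow is represented by exactly one total function.
\<close>

definition flows :: "('a, 'b) pre_digraph \<Rightarrow> ('a \<Rightarrow> real) \<Rightarrow> ('b \<Rightarrow> real) set" where
  "flows G a = {f \<in> arcs G \<rightarrow>\<^sub>E {0..}.
     \<forall>v\<in>verts G. (\<Sum>e\<in>out_arcs G v. f e) - (\<Sum>e\<in>in_arcs G v. f e) = a v}"

definition integer_flows :: "('a, 'b) pre_digraph \<Rightarrow> ('a \<Rightarrow> real) \<Rightarrow> ('b \<Rightarrow> real) set" where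
  "integer_flows G a = {f \<in> flows G a. \<forall>e\<in>arcs G. f e \<in> \<int>}"

text \<open>Shifted in-degrees of \<open>G\<close> with source \<open>x\<close> and sink \<open>y\<close>.\<close>

definition shifted_in_degree :: "('a, 'b) pre_digraph \<Rightarrow> 'a \<Rightarrow> 'a \<Rightarrow> 'a \<Rightarrow> real" where
  "shifted_in_degree G x y v =
     (if v = x then 0
      else if v = y then - (\<Sum>u\<in>verts G - {x, y}. real (in_degree G u) - 1)
      else real (in_degree G v) - 1)"

definition oruga_netflow :: "nat list \<Rightarrow> int \<Rightarrow> real" where
  "oruga_netflow s = shifted_in_degree (oruga s) (-1) (int (length s))"

end

theory Submission
  imports Defs
begin

text \<open>
  Both sets have \<open>\<Prod>i=1..n. (1 + s\<^sub>i\<^sub>+\<^sub>1 + \<dots> + s\<^sub>n)\<close> elements. In a word avoiding \<open>121\<close>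
  the copies of the smallest letter are consecutive, and the block they form can be inserted
  anywhere in a \<open>121\<close>-avoiding word in the larger letters. In a \<open>d\<close>-flow the source
  edges carry \<open>0\<close>, so conservation forces the bump and the dip with index \<open>i\<close> to carry
  \<open>s\<^sub>i\<^sub>+\<^sub>1 + \<dots> + s\<^sub>n\<close> together, and the way this total is split is free.
\<close>

section \<open>Words avoiding 121\<close>

text \<open>Arbitrary letter multisets are allowed so that an induction can strip off the smallest
  letter.\<close>

definition avoiders :: "nat multiset \<Rightarrow> nat list set" where
  "avoiders M = {w. mset w = M \<and> avoids_121 w}"

definition insert_block :: "nat \<Rightarrow> nat \<Rightarrow> nat \<Rightarrow> nat list \<Rightarrow> nat list" where
  "insert_block k x p w = take p w @ replicate k x @ drop p w"

lemma filter_neq_id: "x \<notin> set l \<Longrightarrow> filter (\<lambda>y. y \<noteq> x) l = l"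
  by (auto simp: filter_id_conv)

text \<open>An occurrence of \<open>[a, b, a]\<close> with \<open>a = x\<close> needs a larger
  letter between two copies of \<open>x\<close>, but the copies are consecutive. An occurrence with
  \<open>a > x\<close> has \<open>b > x\<close> too, so it survives the deletion of the block and
  already lies in \<open>u @ t\<close>.\<close>

lemma avoids_121_append_block:
  assumes "avoids_121 (u @ t)" and less: "\<And>y. y \<in> set (u @ t) \<Longrightarrow> x < y"
  shows "avoids_121 (u @ replicate k x @ t)"
  unfolding avoids_121_def
proof (intro notI, elim exE conjE)
  fix a b assume ab: "a < b" and sub: "subseq [a, b, a] (u @ replicate k x @ t)"
  have nx: "x \<notin> set u" "x \<notin> set t"
    using less by fastforce+
  show False
  proof (cases "a = x")
    case True
    have skip: "subseq (x # l) (v @ r) \<Longrightarrow> subseq (x # l) r" if "x \<notin> set v" for v l r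
      using that by (induction v) auto
    have 1: "subseq [x, b, x] (replicate k x @ t)"
      using sub True skip nx(1) by blast
    \<comment> \<open>The letter \<open>b\<close> cannot be matched inside the block, so the final
      \<open>x\<close> would have to come from \<open>t\<close>. The length \<open>m\<close> is
      arbitrary for the sake of the induction.\<close>
    have 2: "\<not> subseq [b, x] (replicate m x @ t)" for m
    proof (induction m)
      case 0
      show ?case
        using nx(2) list_emb_set[of "(=)" "[b, x]" t x] by auto
    next
      case (Suc m)
      then show ?case using ab True by simp
    qed
    have "\<not> subseq [x, b, x] (replicate m x @ t)" for m
    proof (induction m)
      case 0
      show ?case using nx(2) list_emb_set[of "(=)" "[x, b, x]" t x] by auto
    next
      case (Suc m)
      then show ?case using 2 by simp
    qed
    with 1 show False by blast
  next
    case False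
    have "a \<in> set (u @ replicate k x @ t)"
      using list_emb_set[OF sub, of a] by auto
    then have "x < a" using less False by auto
    then have f: "filter (\<lambda>y. y \<noteq> x) [a, b, a] = [a, b, a]" using ab by auto
    have "filter (\<lambda>y. y \<noteq> x) (u @ replicate k x @ t) = u @ t"
      using nx by (simp add: filter_neq_id)
    then have "subseq [a, b, a] (u @ t)"
      using subseq_filter[OF sub, of "\<lambda>y. y \<noteq> x"] f by simp
    with assms(1) ab show False unfolding avoids_121_def by blast
  qed
qed

text \<open>Any other letter between two copies of the minimum \<open>x\<close> is larger and would
  complete a 121, so all copies form one run. If \<open>x\<close> does not occur, the run is
  empty.\<close>

lemma avoids_121_min_block:
  assumes "avoids_121 w" and "\<And>y. y \<in> set w \<Longrightarrow> x \<le> y"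
  obtains u t where "w = u @ replicate (count (mset w) x) x @ t" "x \<notin> set u" "x \<notin> set t"
proof (cases "x \<in> set w")
  case False
  then show ?thesis using that[of w "[]"] by simp
next
  case True
  then obtain u r where w: "w = u @ x # r" and u: "x \<notin> set u"
    using split_list_first by metis
  define t where "t = dropWhile (\<lambda>y. y = x) r"
  have r: "r = takeWhile (\<lambda>y. y = x) r @ t" unfolding t_def by simp
  have t: "x \<notin> set t"
  proof
    assume xt: "x \<in> set t"
    \<comment> \<open>The letter \<open>b\<close> ends the first run of \<open>x\<close>. With the
      \<open>x\<close> right after \<open>u\<close> and one further right in \<open>t'\<close> it
      forms the forbidden \<open>[x, b, x]\<close>.\<close>
    then obtain b t' where t': "t = b # t'" by (cases t) auto
    have "b \<noteq> x"
      using t' hd_dropWhile[of "\<lambda>y. y = x" r] unfolding t_def by fastforce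
    then have "x \<in> set t'" using xt t' by auto
    then have "subseq [x] t'" by (simp add: subseq_singleton_left)
    then have "subseq [b, x] t" using t' by simp
    then have "subseq [b, x] r" using r list_emb_append2 by metis
    then have "subseq [x, b, x] w" unfolding w by (auto intro: list_emb_append2)
    moreover have "b \<in> set w" using t' r w by (metis Un_iff list.set_intros set_append)
    then have "x < b" using assms(2) \<open>b \<noteq> x\<close> by force
    ultimately show False using assms(1) unfolding avoids_121_def by blast
  qed
  have "takeWhile (\<lambda>y. y = x) r = replicate (length (takeWhile (\<lambda>y. y = x) r)) x"
    by (rule replicate_eqI) (auto dest: set_takeWhileD)
  then obtain m where "r = replicate m x @ t" using r by metis
  then have w': "w = u @ replicate (Suc m) x @ t" using w by simp
  then have "count (mset w) x = Suc m"
    using u t by (simp add: count_mset count_list_0_iff not_in_iff)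
  with that w' u t show ?thesis by metis
qed

text \<open>Deleting all \<open>x\<close> recovers \<open>w\<close>, and the position of the first
  \<open>x\<close> recovers \<open>p\<close>; the latter needs a nonempty block. There are
  \<open>size M + 1\<close> gaps.\<close>

lemma bij_betw_insert_block:
  assumes "0 < k" and less: "\<And>y. y \<in># M \<Longrightarrow> x < y"
  shows "bij_betw (\<lambda>(p, w). insert_block k x p w)
    ({..size M} \<times> avoiders M) (avoiders (replicate_mset k x + M))"
  unfolding bij_betw_def
proof
  have M: "set w = set_mset M" "length w = size M" "x \<notin> set w" if "w \<in> avoiders M" for w
    using that less[of x] unfolding avoiders_def by auto
  show "inj_on (\<lambda>(p, w). insert_block k x p w) ({..size M} \<times> avoiders M)"
  proof (rule inj_onI, clarify)
    fix p w q v
    assume p: "p \<le> size M" "w \<in> avoiders M" and q: "q \<le> size M" "v \<in> avoiders M"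
      and eq: "insert_block k x p w = insert_block k x q v"
    obtain m where k: "k = Suc m" using \<open>0 < k\<close> gr0_implies_Suc by blast
    have block: "takeWhile (\<lambda>y. y \<noteq> x) (insert_block k x p w) = take p w
        \<and> filter (\<lambda>y. y \<noteq> x) (insert_block k x p w) = w" if "x \<notin> set w" for p w
    proof
      have nt: "x \<notin> set (take p w)" "x \<notin> set (drop p w)"
        using that by (auto dest: in_set_takeD in_set_dropD)
      then show "takeWhile (\<lambda>y. y \<noteq> x) (insert_block k x p w) = take p w"
        unfolding insert_block_def k by (auto simp: takeWhile_append)
      have "filter (\<lambda>y. y \<noteq> x) (insert_block k x p w) = take p w @ drop p w"
        unfolding insert_block_def filter_append using nt by (simp add: filter_neq_id)
      then show "filter (\<lambda>y. y \<noteq> x) (insert_block k x p w) = w" by simp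
    qed
    have wv: "w = v" and "take p w = take q v"
      using block[of w p] block[of v q] M p q eq by auto
    then have "length (take p w) = length (take q v)" by simp
    then show "p = q \<and> w = v" using M p q wv by auto
  qed
  show "(\<lambda>(p, w). insert_block k x p w) ` ({..size M} \<times> avoiders M)
    = avoiders (replicate_mset k x + M)"
  proof (intro equalityI subsetI)
    fix v assume "v \<in> (\<lambda>(p, w). insert_block k x p w) ` ({..size M} \<times> avoiders M)"
    then obtain p w where w: "w \<in> avoiders M" and v: "v = insert_block k x p w" by auto
    have "mset v = replicate_mset k x + mset (take p w @ drop p w)"
      unfolding v insert_block_def by (simp del: append_take_drop_id)
    moreover have "avoids_121 v"
      unfolding v insert_block_def using w less
      by (intro avoids_121_append_block) (auto simp: avoiders_def)
    ultimately show "v \<in> avoiders (replicate_mset k x + M)"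
      using w by (simp add: avoiders_def)
  next
    fix v assume v: "v \<in> avoiders (replicate_mset k x + M)"
    then have mv: "mset v = replicate_mset k x + M" and av: "avoids_121 v"
      by (auto simp: avoiders_def)
    have "x \<notin># M" using less by blast
    then have cnt: "count (mset v) x = k" using mv by (simp add: not_in_iff)
    have "x \<le> y" if "y \<in> set v" for y
    proof -
      have "y \<in># replicate_mset k x + M" using that mv by (metis set_mset_mset)
      then show ?thesis using less \<open>0 < k\<close> by fastforce
    qed
    then obtain u t where ut: "v = u @ replicate k x @ t"
      using avoids_121_min_block[OF av] cnt by metis
    have "mset (u @ t) = M" using mv ut by simp
    \<comment> \<open>Avoidance passes to subsequences.\<close>
    moreover have "avoids_121 (u @ t)"
    proof -
      have "subseq (u @ t) v" unfolding ut by (intro list_emb_append_mono) auto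
      then show ?thesis using av subseq_order.trans unfolding avoids_121_def by blast
    qed
    ultimately have "u @ t \<in> avoiders M" "length u \<le> size M"
      by (auto simp: avoiders_def)
    moreover have "v = insert_block k x (length u) (u @ t)"
      using ut by (simp add: insert_block_def)
    ultimately show "v \<in> (\<lambda>(p, w). insert_block k x p w) ` ({..size M} \<times> avoiders M)"
      by force
  qed
qed

lemma finite_avoiders: "finite (avoiders M)"
proof (rule finite_subset)
  show "avoiders M \<subseteq> {w. set w \<subseteq> set_mset M \<and> length w = size M}"
    by (auto simp: avoiders_def)
qed (rule finite_lists_length_eq, simp)

section \<open>Counting Stirling permutations\<close>

text \<open>The common quantity of both counts: the number of letters exceeding \<open>i\<close>,
  and the total flow on the bump and dip of index \<open>i\<close>. The conventional part with index
  \<open>length s + 1\<close> is left out, so the last value is 0.\<close>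

definition tail_sum :: "nat list \<Rightarrow> nat \<Rightarrow> nat" where
  "tail_sum s i = (\<Sum>j\<in>{i+1..length s}. part s j)"

lemma part_pos:
  assumes "composition s" "1 \<le> i" "i \<le> length s + 1"
  shows "0 < part s i"
  using assms by (auto simp: part_def composition_def)

lemma tail_sum_Suc:
  assumes "i < length s"
  shows "tail_sum s i = part s (Suc i) + tail_sum s (Suc i)"
  using assms unfolding tail_sum_def by (simp add: sum.atLeast_Suc_atMost)

text \<open>Downward induction on \<open>k\<close>: \<open>letters (Suc k)\<close> holds the letters
  above \<open>k\<close>, and each step inserts the block of the next smaller letter. The size is
  carried along because it gives the number of gaps.\<close>

lemma card_avoiders_suffix:
  assumes "composition s" "k \<le> length s"
  defines "letters i \<equiv> mset (concat (map (\<lambda>i. replicate (part s i) i) [i..<length s + 1]))"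
  shows "size (letters (Suc k)) = tail_sum s k
    \<and> card (avoiders (letters (Suc k))) = (\<Prod>i\<in>{Suc k..length s}. Suc (tail_sum s i))"
  using assms(2)
proof (induction rule: inc_induct)
  case base
  have "avoiders {#} = {[]}"
    by (auto simp: avoiders_def avoids_121_def)
  then show ?case by (simp add: letters_def tail_sum_def)
next
  case (step k)
  have suf: "letters (Suc k) = replicate_mset (part s (Suc k)) (Suc k) + letters (Suc (Suc k))"
    using step.hyps unfolding letters_def by (simp add: upt_conv_Cons del: upt_Suc)
  have "bij_betw (\<lambda>(p, w). insert_block (part s (Suc k)) (Suc k) p w)
      ({..size (letters (Suc (Suc k)))} \<times> avoiders (letters (Suc (Suc k))))
      (avoiders (letters (Suc k)))"
    unfolding suf
    by (rule bij_betw_insert_block)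
      (use step.hyps in \<open>auto simp: letters_def part_pos[OF assms(1)] simp del: upt_Suc\<close>)
  from bij_betw_same_card[OF this]
  have "card (avoiders (letters (Suc k)))
      = Suc (tail_sum s (Suc k)) * card (avoiders (letters (Suc (Suc k))))"
    using step.IH by (simp add: card_cartesian_product)
  then show ?case
    using step suf by (simp add: tail_sum_Suc prod.atLeast_Suc_atMost[of "Suc k"])
qed

lemma card_stirling_permutations:
  assumes "composition s"
  shows "card (stirling_permutations s) = (\<Prod>i\<in>{1..length s}. Suc (tail_sum s i))"
  using card_avoiders_suffix[OF assms, of 0]
  by (simp add: stirling_permutations_def avoiders_def base_word_def del: upt_Suc)

section \<open>The oruga graph\<close>

text \<open>Apart from the source, vertices are indexed by the natural number \<open>i\<close> of
  the edges entering them: \<open>i = 1\<close> is the sink and \<open>i = length s + 1\<close> is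
  vertex 0.\<close>

lemma verts_oruga:
  "verts (oruga s) = insert (-1) ((\<lambda>i. int (length s) + 1 - int i) ` {1..length s + 1})"
proof (intro equalityI subsetI)
  fix v assume v: "v \<in> verts (oruga s)"
  show "v \<in> insert (-1) ((\<lambda>i. int (length s) + 1 - int i) ` {1..length s + 1})"
  proof (cases "v = -1")
    case False
    then have "v = int (length s) + 1 - int (nat (int (length s) + 1 - v))"
      "nat (int (length s) + 1 - v) \<in> {1..length s + 1}"
      using v by (auto simp: oruga_def)
    then show ?thesis by blast
  qed simp
qed (auto simp: oruga_def)

lemma in_arcs_oruga:
  assumes "i \<in> {1..length s + 1}"
  shows "in_arcs (oruga s) (int (length s) + 1 - int i)
    = Source i ` {1..part s i - 1} \<union> (if i \<le> length s then {Bump i, Dip i} else {})"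
  using assms by (auto simp: in_arcs_def oruga_def)

lemma in_arcs_oruga_source: "in_arcs (oruga s) (-1) = {}"
  by (auto simp: in_arcs_def oruga_def)

lemma out_arcs_oruga:
  assumes "i \<in> {1..length s + 1}"
  shows "out_arcs (oruga s) (int (length s) + 1 - int i)
    = (if i = 1 then {} else {Bump (i - 1), Dip (i - 1)})"
proof -
  have "Bump (i - 1) \<in> Bump ` {1..length s}" "Dip (i - 1) \<in> Dip ` {1..length s}" if "i \<noteq> 1"
    using assms that by (auto intro!: imageI)
  with assms show ?thesis by (auto simp: out_arcs_def oruga_def)
qed

lemma out_arcs_oruga_source:
  "out_arcs (oruga s) (-1)
    = {Source i j | i j. i \<in> {1..length s + 1} \<and> j \<in> {1..part s i - 1}}"
  by (auto simp: out_arcs_def oruga_def)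

lemma in_degree_oruga:
  assumes "i \<in> {1..length s + 1}"
  shows "in_degree (oruga s) (int (length s) + 1 - int i)
    = part s i - 1 + (if i \<le> length s then 2 else 0)"
proof -
  have "card (Source i ` {1..part s i - 1}) = part s i - 1"
    by (simp add: card_image inj_on_def)
  then show ?thesis
    unfolding in_degree_def in_arcs_oruga[OF assms]
    by (subst card_Un_disjoint) auto
qed

lemma finite_sources:
  "finite {Source i j | i j. i \<in> {1..n :: nat} \<and> j \<in> {1..m i :: nat}}"
proof -
  have "{Source i j | i j. i \<in> {1..n} \<and> j \<in> {1..m i}}
      = (\<lambda>(i, j). Source i j) ` (SIGMA i:{1..n}. {1..m i})"
    by auto
  then show ?thesis by simp
qed

lemma oruga_netflow_source: "oruga_netflow s (-1) = 0"
  by (simp add: oruga_netflow_def shifted_in_degree_def)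

text \<open>An inner vertex receives \<open>part s i - 1\<close> source edges, a bump and a dip.
  Vertex 0 receives a single source edge, by the convention that the extra part is 2, so its shifted
  in-degree is 0.\<close>

lemma oruga_netflow_inner:
  assumes "composition s" "i \<in> {2..length s + 1}"
  shows "oruga_netflow s (int (length s) + 1 - int i)
    = (if i = length s + 1 then 0 else real (part s i))"
proof -
  have "oruga_netflow s (int (length s) + 1 - int i)
      = real (part s i - 1 + (if i \<le> length s then 2 else 0)) - 1"
    using in_degree_oruga[of i s] assms(2)
    by (simp add: oruga_netflow_def shifted_in_degree_def)
  then show ?thesis
    using part_pos[OF assms(1), of i] assms(2) by (auto simp: part_def of_nat_diff)
qed

lemma oruga_netflow_sink:
  assumes "composition s"
  shows "oruga_netflow s (int (length s)) = - (\<Sum>i\<in>{2..length s}. real (part s i))"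
proof -
  let ?n = "length s"
  let ?v = "\<lambda>i. int ?n + 1 - int i"
  have "?v ` {1..?n + 1} = insert (int ?n) (?v ` {2..?n + 1})"
  proof -
    have "{1..?n + 1} = insert 1 {2..?n + 1}" by auto
    then show ?thesis by simp
  qed
  then have V: "verts (oruga s) - {-1, int ?n} = ?v ` {2..?n + 1}"
    unfolding verts_oruga by auto
  \<comment> \<open>Away from source and sink the summand defining the sink value is the netflow
    itself, already computed.\<close>
  have "(\<Sum>u\<in>?v ` {2..?n + 1}. real (in_degree (oruga s) u) - 1)
      = (\<Sum>u\<in>?v ` {2..?n + 1}. oruga_netflow s u)"
    by (rule sum.cong) (auto simp: oruga_netflow_def shifted_in_degree_def)
  also have "\<dots> = (\<Sum>i\<in>{2..?n + 1}. oruga_netflow s (?v i))"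
    by (subst sum.reindex) (auto simp: inj_on_def)
  also have "\<dots> = (\<Sum>i\<in>{2..?n + 1}. if i = ?n + 1 then 0 else real (part s i))"
    by (rule sum.cong) (use oruga_netflow_inner[OF assms] in auto)
  also have "\<dots> = (\<Sum>i\<in>{2..?n}. real (part s i))"
    by (rule sum.mono_neutral_cong_right) auto
  finally show ?thesis
    unfolding V[symmetric] by (simp add: oruga_netflow_def shifted_in_degree_def)
qed

lemma netflow_shifted_in_degree:
  assumes "finite (verts G)" "x \<in> verts G" "y \<in> verts G" "x \<noteq> y"
  shows "netflow G (shifted_in_degree G x y)"
proof -
  have "(\<Sum>v\<in>verts G. shifted_in_degree G x y v)
      = shifted_in_degree G x y x + (shifted_in_degree G x y y
        + (\<Sum>v\<in>verts G - {x, y}. shifted_in_degree G x y v))"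
    using assms
    by (simp add: sum.remove[of _ x] sum.remove[of _ y] Diff_insert2[symmetric] insert_commute)
  also have "(\<Sum>v\<in>verts G - {x, y}. shifted_in_degree G x y v)
      = (\<Sum>v\<in>verts G - {x, y}. real (in_degree G v) - 1)"
    by (rule sum.cong) (auto simp: shifted_in_degree_def)
  finally show ?thesis
    using assms(4) by (simp add: netflow_def shifted_in_degree_def)
qed

lemma netflow_oruga: "netflow (oruga s) (oruga_netflow s)"
  unfolding oruga_netflow_def
  by (rule netflow_shifted_in_degree) (auto simp: oruga_def)

section \<open>Counting integer flows\<close>

text \<open>\<open>g i\<close> is the amount sent over bump \<open>i\<close>; the dip takes the
  rest. The truncated subtraction is exact when \<open>g i \<le> tail_sum s i\<close>. Restriction
  to the arcs matches the extensionality of flows.\<close>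

definition split_flow :: "nat list \<Rightarrow> (nat \<Rightarrow> nat) \<Rightarrow> oruga_edge \<Rightarrow> real" where
  "split_flow s g = (\<lambda>e\<in>arcs (oruga s).
     case e of Source i j \<Rightarrow> 0 | Bump i \<Rightarrow> real (g i) | Dip i \<Rightarrow> real (tail_sum s i - g i))"

text \<open>Here \<open>F i\<close> stands for the joint flow on bump and dip \<open>i\<close>. The
  system is triangular: vertex 0 forces \<open>F (length s) = 0\<close>, each inner vertex gives
  \<open>F (i - 1) = F i + part s i\<close>, and the sink equation is consistent with the
  solution.\<close>

lemma conservation_iff:
  fixes F :: "nat \<Rightarrow> real"
  assumes "composition s"
  shows "(\<forall>i\<in>{1..length s + 1}. (if i = 1 then 0 else F (i - 1)) - (if i \<le> length s then F i else 0)
      = oruga_netflow s (int (length s) + 1 - int i))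
    \<longleftrightarrow> (\<forall>i\<in>{1..length s}. F i = real (tail_sum s i))" (is "?L \<longleftrightarrow> ?R")
proof
  assume L: ?L
  show ?R
  proof
    fix i assume "i \<in> {1..length s}"
    then have "i \<le> length s" "1 \<le> i" by auto
    then show "F i = real (tail_sum s i)"
    proof (induction rule: inc_induct)
      case base
      show ?case
        using L[rule_format, of "length s + 1"] oruga_netflow_inner[OF assms, of "length s + 1"] base
        by (simp add: tail_sum_def split: if_splits)
    next
      case (step i)
      then show ?case
        using L[rule_format, of "Suc i"] oruga_netflow_inner[OF assms, of "Suc i"]
        by (simp add: tail_sum_Suc)
    qed
  qed
next
  assume R: ?R
  show ?L
  proof
    fix i assume i: "i \<in> {1..length s + 1}"
    show "(if i = 1 then 0 else F (i - 1)) - (if i \<le> length s then F i else 0)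
      = oruga_netflow s (int (length s) + 1 - int i)"
    proof (cases "i = 1")
      case True
      then show ?thesis
        using R oruga_netflow_sink[OF assms] by (auto simp: tail_sum_def numeral_2_eq_2)
    next
      case False
      then obtain k where "i = Suc k" "1 \<le> k" "k \<le> length s"
        using i by (cases i) auto
      then show ?thesis
        using R oruga_netflow_inner[OF assms, of i] tail_sum_Suc[of k s]
        \<comment> \<open>At vertex 0 the netflow is 0 rather than the conventional part 2, so the
          recursion for \<open>tail_sum\<close> does not apply there.\<close>
        by (cases "k = length s") (simp_all add: tail_sum_def[of s "length s"])
    qed
  qed
qed

text \<open>The source has netflow 0 and no incoming arcs, so nonnegativity makes every source edge
  carry 0. The remaining equations then involve only the bump and dip totals.\<close>

lemma flows_oruga_iff:
  assumes "composition s"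
  shows "f \<in> flows (oruga s) (oruga_netflow s) \<longleftrightarrow> f \<in> arcs (oruga s) \<rightarrow>\<^sub>E {0..}
    \<and> (\<forall>i\<in>{1..length s + 1}. \<forall>j\<in>{1..part s i - 1}. f (Source i j) = 0)
    \<and> (\<forall>i\<in>{1..length s}. f (Bump i) + f (Dip i) = real (tail_sum s i))"
proof -
  let ?v = "\<lambda>i. int (length s) + 1 - int i"
  let ?excess = "\<lambda>v. (\<Sum>e\<in>out_arcs (oruga s) v. f e) - (\<Sum>e\<in>in_arcs (oruga s) v. f e)"
  let ?S = "{Source i j | i j. i \<in> {1..length s + 1} \<and> j \<in> {1..part s i - 1}}"
  let ?zero = "\<forall>i\<in>{1..length s + 1}. \<forall>j\<in>{1..part s i - 1}. f (Source i j) = 0"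
  have source: "?excess (-1) = oruga_netflow s (-1) \<longleftrightarrow> ?zero"
    if f: "f \<in> arcs (oruga s) \<rightarrow>\<^sub>E {0..}"
  proof -
    have "sum f ?S = 0 \<longleftrightarrow> (\<forall>e\<in>?S. f e = 0)"
    proof (rule sum_nonneg_eq_0_iff[OF finite_sources])
      fix e assume "e \<in> ?S"
      then have "e \<in> arcs (oruga s)" by (auto simp: oruga_def)
      then show "0 \<le> f e" using f by (auto simp: PiE_iff)
    qed
    also have "\<dots> \<longleftrightarrow> ?zero" by blast
    finally show ?thesis
      unfolding out_arcs_oruga_source in_arcs_oruga_source oruga_netflow_source by simp
  qed
  have inner: "?excess (?v i) = (if i = 1 then 0 else f (Bump (i - 1)) + f (Dip (i - 1)))
      - (if i \<le> length s then f (Bump i) + f (Dip i) else 0)"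
    if "?zero" "i \<in> {1..length s + 1}" for i
  proof -
    have "sum f (Source i ` {1..part s i - 1}) = 0"
      using that by (intro sum.neutral) auto
    moreover have "sum f (Source i ` {1..part s i - 1} \<union> {Bump i, Dip i})
        = sum f (Source i ` {1..part s i - 1}) + sum f {Bump i, Dip i}"
      by (rule sum.union_disjoint) auto
    ultimately show ?thesis
      unfolding in_arcs_oruga[OF that(2)] out_arcs_oruga[OF that(2)] by simp
  qed
  have "(\<forall>v\<in>verts (oruga s). ?excess v = oruga_netflow s v) \<longleftrightarrow>
      ?zero \<and> (\<forall>i\<in>{1..length s}. f (Bump i) + f (Dip i) = real (tail_sum s i))"
    if f: "f \<in> arcs (oruga s) \<rightarrow>\<^sub>E {0..}"
  proof -
    have "(\<forall>v\<in>verts (oruga s). ?excess v = oruga_netflow s v) \<longleftrightarrow>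
        ?zero \<and> (\<forall>i\<in>{1..length s + 1}. ?excess (?v i) = oruga_netflow s (?v i))"
      unfolding verts_oruga using source[OF f] by blast
    also have "\<dots> \<longleftrightarrow> ?zero \<and> (\<forall>i\<in>{1..length s + 1}.
        (if i = 1 then 0 else f (Bump (i - 1)) + f (Dip (i - 1)))
        - (if i \<le> length s then f (Bump i) + f (Dip i) else 0) = oruga_netflow s (?v i))"
      \<comment> \<open>\<open>conj_cong\<close> supplies \<open>?zero\<close> while the second
        conjunct is rewritten, as \<open>inner\<close> requires.\<close>
      by (intro conj_cong refl ball_cong) (simp add: inner)
    also have "\<dots> \<longleftrightarrow> ?zero \<and> (\<forall>i\<in>{1..length s}. f (Bump i) + f (Dip i) = real (tail_sum s i))"
      using conservation_iff[OF assms, of "\<lambda>i. f (Bump i) + f (Dip i)"] by simp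
    finally show ?thesis .
  qed
  then show ?thesis unfolding flows_def by blast
qed

lemma split_flow_simps:
  "i \<in> {1..length s + 1} \<Longrightarrow> j \<in> {1..part s i - 1} \<Longrightarrow> split_flow s g (Source i j) = 0"
  "i \<in> {1..length s} \<Longrightarrow> split_flow s g (Bump i) = real (g i)"
  "i \<in> {1..length s} \<Longrightarrow> split_flow s g (Dip i) = real (tail_sum s i - g i)"
  by (auto simp: split_flow_def oruga_def)

lemma arcs_oruga_cases:
  assumes "e \<in> arcs (oruga s)"
  obtains i j where "e = Source i j" "i \<in> {1..length s + 1}" "j \<in> {1..part s i - 1}"
    | i where "e = Bump i" "i \<in> {1..length s}"
    | i where "e = Dip i" "i \<in> {1..length s}"
  using assms by (auto simp: oruga_def)

lemma bij_betw_split_flow: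
  assumes "composition s"
  shows "bij_betw (split_flow s) (\<Pi>\<^sub>E i\<in>{1..length s}. {..tail_sum s i})
    (integer_flows (oruga s) (oruga_netflow s))"
  unfolding bij_betw_def
proof
  let ?P = "\<Pi>\<^sub>E i\<in>{1..length s}. {..tail_sum s i}"
  show "inj_on (split_flow s) ?P"
  proof (rule inj_onI)
    fix g h assume g: "g \<in> ?P" and h: "h \<in> ?P" and eq: "split_flow s g = split_flow s h"
    show "g = h"
    proof (rule PiE_ext[OF g h])
      fix i assume "i \<in> {1..length s}"
      then show "g i = h i"
        using fun_cong[OF eq, of "Bump i"] by (simp add: split_flow_simps)
    qed
  qed
  show "split_flow s ` ?P = integer_flows (oruga s) (oruga_netflow s)"
  proof (intro equalityI subsetI)
    fix f assume "f \<in> split_flow s ` ?P"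
    then obtain g where g: "g \<in> ?P" and f: "f = split_flow s g" by blast
    have int: "f e \<in> \<int> \<and> 0 \<le> f e" if "e \<in> arcs (oruga s)" for e
      using that unfolding f by (cases rule: arcs_oruga_cases) (simp_all add: split_flow_simps)
    have ext: "f \<in> arcs (oruga s) \<rightarrow>\<^sub>E {0..}"
    proof (rule PiE_I)
      show "f e \<in> {0..}" if "e \<in> arcs (oruga s)" for e using int[OF that] by simp
      show "f e = undefined" if "e \<notin> arcs (oruga s)" for e using that by (simp add: f split_flow_def)
    qed
    have "f (Bump i) + f (Dip i) = real (tail_sum s i)" if i: "i \<in> {1..length s}" for i
    proof -
      have "g i \<le> tail_sum s i" using g i by (auto simp: PiE_iff)
      then show ?thesis using i by (simp add: f split_flow_simps of_nat_diff)
    qed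
    then show "f \<in> integer_flows (oruga s) (oruga_netflow s)"
      unfolding integer_flows_def mem_Collect_eq flows_oruga_iff[OF assms]
      using int ext by (simp add: f split_flow_simps)
  next
    fix f assume "f \<in> integer_flows (oruga s) (oruga_netflow s)"
    then have int: "\<And>e. e \<in> arcs (oruga s) \<Longrightarrow> f e \<in> \<int>"
      and ext: "f \<in> arcs (oruga s) \<rightarrow>\<^sub>E {0..}"
      and zero: "\<And>i j. i \<in> {1..length s + 1} \<Longrightarrow> j \<in> {1..part s i - 1} \<Longrightarrow> f (Source i j) = 0"
      and sum: "\<And>i. i \<in> {1..length s} \<Longrightarrow> f (Bump i) + f (Dip i) = real (tail_sum s i)"
      unfolding integer_flows_def mem_Collect_eq flows_oruga_iff[OF assms] by blast+
    \<comment> \<open>Integrality and nonnegativity make \<open>floor\<close> and \<open>nat\<close>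
      lossless on the bump values; nonnegativity of the dip gives the upper bound on
      \<open>g i\<close>.\<close>
    define g where "g = (\<lambda>i\<in>{1..length s}. nat \<lfloor>f (Bump i)\<rfloor>)"
    have g: "f (Bump i) = real (g i)" "g i \<le> tail_sum s i"
      "f (Dip i) = real (tail_sum s i - g i)" if i: "i \<in> {1..length s}" for i
    proof -
      have arcs: "Bump i \<in> arcs (oruga s)" "Dip i \<in> arcs (oruga s)" using i by (auto simp: oruga_def)
      then have nonneg: "0 \<le> f (Bump i)" "0 \<le> f (Dip i)"
        using ext by (auto simp: PiE_iff)
      show B: "f (Bump i) = real (g i)"
        using int[OF arcs(1)] nonneg(1) i by (auto simp: g_def elim!: Ints_cases)
      show le: "g i \<le> tail_sum s i" using sum[OF i] B nonneg(2) by linarith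
      show "f (Dip i) = real (tail_sum s i - g i)" using sum[OF i] B le by (simp add: of_nat_diff)
    qed
    have "f e = split_flow s g e" for e
    proof (cases "e \<in> arcs (oruga s)")
      case True
      then show ?thesis
        by (cases rule: arcs_oruga_cases) (simp_all add: split_flow_simps zero g)
    next
      case False
      then show ?thesis using ext by (auto simp: split_flow_def PiE_iff extensional_def)
    qed
    then have "f = split_flow s g" by blast
    moreover have "g \<in> ?P" using g(2) by (auto simp: g_def)
    ultimately show "f \<in> split_flow s ` ?P" by blast
  qed
qed

theorem theorem6p4:
  fixes s :: "nat list" and n :: nat and d :: "int \<Rightarrow> real"
  assumes "composition s" and "n = length s" and "d = oruga_netflow s"
  shows "netflow (oruga s) d
    \<and> d (-1) = 0 \<and> d 0 = 0
    \<and> (\<forall>i\<in>{2..n}. d (int n + 1 - int i) = real (part s i))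
    \<and> d (int n) = - (\<Sum>i\<in>{2..n}. real (part s i))
    \<and> (\<exists>\<phi>. bij_betw \<phi> (stirling_permutations s) (integer_flows (oruga s) d))"
proof -
  \<comment> \<open>For the empty composition vertex 0 is the sink, whose value is an empty
    sum.\<close>
  have "d 0 = 0"
  proof (cases "length s = 0")
    case True
    then show ?thesis using oruga_netflow_sink[OF assms(1)] assms(3) by simp
  next
    case False
    then have "length s + 1 \<in> {2..length s + 1}" by (simp add: Suc_le_eq)
    from oruga_netflow_inner[OF assms(1) this] show ?thesis using assms(3) by simp
  qed
  moreover have "\<forall>i\<in>{2..n}. d (int n + 1 - int i) = real (part s i)"
    using oruga_netflow_inner[OF assms(1)] assms(2,3) by auto
  moreover have "\<exists>\<phi>. bij_betw \<phi> (stirling_permutations s) (integer_flows (oruga s) d)"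
  proof (rule finite_same_card_bij)
    let ?P = "\<Pi>\<^sub>E i\<in>{1..length s}. {..tail_sum s i}"
    have bij: "bij_betw (split_flow s) ?P (integer_flows (oruga s) d)"
      using bij_betw_split_flow[OF assms(1)] assms(3) by simp
    have "finite ?P" by (intro finite_PiE) auto
    then show "finite (integer_flows (oruga s) d)" using bij bij_betw_finite by blast
    show "finite (stirling_permutations s)"
      using finite_avoiders by (simp add: stirling_permutations_def avoiders_def)
    \<comment> \<open>The product of the sizes \<open>Suc (tail_sum s i)\<close> of the ranges for
      \<open>g i\<close> is exactly the count of the words.\<close>
    show "card (stirling_permutations s) = card (integer_flows (oruga s) d)"
      using bij_betw_same_card[OF bij] card_stirling_permutations[OF assms(1)]
      by (simp add: card_PiE)
  qed
  ultimately show ?thesis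
    using netflow_oruga oruga_netflow_source oruga_netflow_sink[OF assms(1)] assms(2,3) by simp
qed

end
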